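(* Let $G$ be a finite group and let $S$ be a $2$-separable generating set of $G$ with $1\in S$, $|S|\ge 3$ and $|G|\ge 2\alpha_2(S)+\kappa_2(S)$. Let $A$ be a $2$-atom of $S$ with $|A|\ge 3$. If $A$ is not left-periodic, then $|A|\le \kappa_2(S)-|S|+3$.
   Context: Let $G$ be a finite group and $S$ a generating subset of $G$ containing $1$. For $X\subseteq G$ put $\partial X=XS\setminus X$ and $X^*=G\setminus (X\cup\partial X)=G\setminus XS$. For $k\ge 1$, $S$ is $k$-separable if there is $X\subseteq G$ with $|X|\ge k$ and $|X^*|\ge k$. If $S$ is $k$-separable, $\kappa_k(S)=\min\{|\partial X| : |X|\ge k,\ |X^*|\ge k\}$; a set $X$ with $|X|\ge k$, $|X^*|\ge k$ achieving this minimum is a $k$-fragment of $S$; a $k$-fragment of minimum cardinality is a $k$-atom of $S$; $\alpha_k(S)$ is the cardinality of a $k$-atom of $S$. A set $A\subseteq G$ is left-periodic if there is $x\in G$, $x\ne 1$, with $xA=A$. *)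

theory Defs
  imports "HOL-Algebra.Generated_Groups"
begin

definition bdry :: "('a, 'b) monoid_scheme \<Rightarrow> 'a set \<Rightarrow> 'a set \<Rightarrow> 'a set" where
  "bdry G S X = (X <#>\<^bsub>G\<^esub> S) - X"

definition star_compl :: "('a, 'b) monoid_scheme \<Rightarrow> 'a set \<Rightarrow> 'a set \<Rightarrow> 'a set" where
  "star_compl G S X = carrier G - (X \<union> bdry G S X)"

definition admissible :: "('a, 'b) monoid_scheme \<Rightarrow> 'a set \<Rightarrow> nat \<Rightarrow> 'a set \<Rightarrow> bool" where
  "admissible G S k X \<longleftrightarrow>
     X \<subseteq> carrier G \<and> k \<le> card X \<and> k \<le> card (star_compl G S X)"

definition separable :: "('a, 'b) monoid_scheme \<Rightarrow> nat \<Rightarrow> 'a set \<Rightarrow> bool" where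
  "separable G k S \<longleftrightarrow> (\<exists>X. admissible G S k X)"

(* Min is over a nonempty finite set, hence meaningful, only when G is finite and
   S is k-separable; the same holds for alpha below. *)
definition kappa :: "('a, 'b) monoid_scheme \<Rightarrow> nat \<Rightarrow> 'a set \<Rightarrow> nat" where
  "kappa G k S = Min {card (bdry G S X) | X. admissible G S k X}"

definition fragment :: "('a, 'b) monoid_scheme \<Rightarrow> nat \<Rightarrow> 'a set \<Rightarrow> 'a set \<Rightarrow> bool" where
  "fragment G k S X \<longleftrightarrow> admissible G S k X \<and> card (bdry G S X) = kappa G k S"

definition atom :: "('a, 'b) monoid_scheme \<Rightarrow> nat \<Rightarrow> 'a set \<Rightarrow> 'a set \<Rightarrow> bool" where
  "atom G k S A \<longleftrightarrow> fragment G k S A \<and> (\<forall>F. fragment G k S F \<longrightarrow> card A \<le> card F)"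

definition alpha :: "('a, 'b) monoid_scheme \<Rightarrow> nat \<Rightarrow> 'a set \<Rightarrow> nat" where
  "alpha G k S = Min {card F | F. fragment G k S F}"

definition left_periodic :: "('a, 'b) monoid_scheme \<Rightarrow> 'a set \<Rightarrow> bool" where
  "left_periodic G A \<longleftrightarrow>
     (\<exists>x \<in> carrier G. x \<noteq> \<one>\<^bsub>G\<^esub> \<and> x <#\<^bsub>G\<^esub> A = A)"

lemma (in group) alpha_eq_card_atom:
  assumes "finite (carrier G)" and "atom G k S A"
  shows "alpha G k S = card A"
proof -
  have "{F. fragment G k S F} \<subseteq> Pow (carrier G)"
    by (auto simp: fragment_def admissible_def)
  then have "finite {F. fragment G k S F}"
    using assms(1) by (simp add: finite_subset)
  then have "finite {card F | F. fragment G k S F}"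
    by simp
  then show ?thesis
    using assms(2) unfolding alpha_def atom_def by (auto intro!: Min_eqI)
qed

end

theory Submission
  imports Defs
begin

text \<open>
  Write \<open>\<phi>(X) = |XS| - |X|\<close>, which is \<open>|\<partial>X|\<close> because \<open>1 \<in> S\<close>, and let \<open>k = |A|\<close>,
  \<open>\<kappa> = \<kappa>\<^sub>2(S)\<close>. The function \<open>\<phi>\<close> is submodular and invariant under left translation, so the size
  condition on \<open>G\<close> forces two distinct left translates of the 2-atom \<open>A\<close> to meet in at most one
  point. As \<open>A\<close> is not left-periodic, this says that \<open>A\<close> is a Sidon set: \<open>|A \<inter> xA| \<le> 1\<close> for
  \<open>x \<noteq> 1\<close>. Translating, one may assume \<open>1 \<in> A\<close>. The claim becomes \<open>|AS| \<ge> |S| + 2k - 3\<close>,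
  which is a statement about the growth of \<open>S\<close> under left multiplication by \<open>A\<close>.

  The heart of the proof (\<open>sidon_generating_excess\<close>) is that if the Sidon set \<open>A\<close> generates \<open>G\<close> then
  \<open>|AY| \<ge> |Y| + 2k - 3\<close> for every \<open>Y\<close> with \<open>|Y| \<ge> 2\<close> and \<open>|G - AY| \<ge> 2\<close>. To see this, apply the
  isoperimetric method to \<open>A\<close> itself: take \<open>B\<close> minimising first \<open>c = |AB| - |B|\<close> and then \<open>|B|\<close>. The
  complement \<open>G - AB\<close> plays the same role for the set of inverses of \<open>A\<close>, which is again a Sidon set, so
  after exchanging the two sets if necessary \<open>|G| \<ge> 2|B| + c\<close>, and distinct right translates of
  \<open>B\<close> meet in at most one point. Hence distinct left translates of \<open>B\<close> meet in at most
  \<open>h = |H|\<close> points, \<open>H\<close> being the right stabiliser of \<open>B\<close>. Suppose \<open>c \<le> 2k - 4\<close>.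
  Counting incidences twice by Cauchy-Schwarz, once with \<open>AB\<close> as the union of the sets \<open>aB\<close> and
  once as the union of the sets \<open>Ab\<close>, is contradictory when \<open>B\<close> consists of at least two left cosets
  of \<open>H\<close>, except for \<open>k = 3\<close>, \<open>|B| = 4\<close>, \<open>h = 2\<close>. There \<open>H\<close> contains an involution \<open>t\<close>, and
  the Sidon property makes \<open>Ab\<close> and \<open>Abt\<close> disjoint, so that \<open>AB\<close> is too large. When \<open>B\<close>
  is a single left coset of \<open>H\<close>, its left translates are equal or disjoint; disjoint ones would
  make \<open>AB\<close> too large, so \<open>AB = B\<close> and hence \<open>B = G\<close>, contrary to \<open>|G - AB| \<ge> 2\<close>.

  In general let \<open>H\<close> be the subgroup generated by \<open>A\<close> and cut \<open>S\<close> along the right cosets of \<open>H\<close>. A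
  part \<open>T = S \<inter> Q\<close> with \<open>T \<noteq> {}\<close> and \<open>AT \<noteq> Q\<close> satisfies \<open>|AT| - |T| \<ge> k - 1\<close>, and even
  \<open>|AT| - |T| \<ge> 2k - 3\<close> if \<open>|T| \<ge> 2\<close> and \<open>|Q - AT| \<ge> 2\<close>. So the claim can fail only if there is at
  most one such part, and it has \<open>|T| = 1\<close> or \<open>|Q - AT| = 1\<close>. In each case comparing \<open>A\<close>
  with \<open>H\<close>, or with \<open>{1, a}\<close> for some \<open>a \<in> A - {1}\<close>, contradicts that \<open>A\<close> is a 2-atom and not
  left-periodic.
\<close>

section \<open>Submodularity and incidence counting\<close>

text \<open>
  The intersection property of atoms, for any set function \<open>N\<close> behaving like \<open>X \<mapsto> XS\<close> or
  \<open>X \<mapsto> AX\<close>. If \<open>B\<close> and \<open>C\<close> met in \<open>2 \<le> j < |B|\<close> points, then submodularity would give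
  \<open>|N(B \<union> C)| < |B \<union> C| + c\<close>; this contradicts \<open>iso\<close> if \<open>N(B \<union> C)\<close> omits two points, and
  the size condition otherwise.
\<close>

lemma submodular_intersection:
  fixes N :: "'a set \<Rightarrow> 'a set"
  assumes fin: "finite V" and B: "B \<subseteq> V" and C: "C \<subseteq> V"
    and N_sub: "\<And>X. X \<subseteq> V \<Longrightarrow> N X \<subseteq> V"
    and N_Un: "N (B \<union> C) = N B \<union> N C"
    and N_Int: "N (B \<inter> C) \<subseteq> N B \<inter> N C"
    and cards: "card C = card B" "card (N B) = card B + c" "card (N C) = card B + c"
    and large: "2 * card B + c \<le> card V"
    and iso: "\<And>U. U \<subseteq> V \<Longrightarrow> 2 \<le> card U \<Longrightarrow> card (N U) + 2 \<le> card V \<Longrightarrow> card U + c \<le> card (N U)"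
    and strict: "\<And>J. J \<subseteq> V \<Longrightarrow> 2 \<le> card J \<Longrightarrow> card J < card B \<Longrightarrow> card (N J) + 2 \<le> card V
      \<Longrightarrow> card J + c < card (N J)"
  shows "card (B \<inter> C) \<le> 1 \<or> B = C"
proof (rule ccontr)
  assume neg: "\<not> ?thesis"
  note fins = finite_subset[OF _ fin]
  have fB: "finite B" "finite C" "finite (N B)" "finite (N C)"
    using fins B C N_sub by auto
  have lt: "card (B \<inter> C) < card B"
  proof (rule ccontr)
    assume "\<not> ?thesis"
    then have "B \<inter> C = B" using card_seteq[of B "B \<inter> C"] fB by auto
    then show False using card_subset_eq[of C B] fB cards neg by auto
  qed
  have J2: "2 \<le> card (B \<inter> C)" using neg by simp
  have "card (N (B \<inter> C)) \<le> card (N B)"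
    using N_Int fB by (intro card_mono) auto
  then have J: "card (B \<inter> C) + c < card (N (B \<inter> C))"
    using strict[of "B \<inter> C"] lt J2 B cards large by auto
  have NJ: "card (N (B \<inter> C)) \<le> card (N B \<inter> N C)"
    using N_Int fB by (intro card_mono) auto
  have u1: "card (N (B \<union> C)) + card (N B \<inter> N C) = 2 * card B + 2 * c"
    using card_Un_Int[of "N B" "N C"] fB cards N_Un by simp
  have u2: "card (B \<union> C) + card (B \<inter> C) = 2 * card B"
    using card_Un_Int[of B C] fB cards by simp
  have less: "card (N (B \<union> C)) < card (B \<union> C) + c"
    using u1 u2 J NJ by linarith
  show False
  proof (cases "card (N (B \<union> C)) + 2 \<le> card V")
    case True
    have "2 \<le> card (B \<union> C)" using u2 lt by linarith
    then show False using iso[of "B \<union> C"] True B C less by auto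
  next
    case False
    then show False using less u2 J2 large by linarith
  qed
qed

lemma square_sum_le_card_mult_sum_squares:
  fixes d :: "'a \<Rightarrow> int"
  assumes "finite U"
  shows "(\<Sum>u\<in>U. d u)\<^sup>2 \<le> int (card U) * (\<Sum>u\<in>U. (d u)\<^sup>2)"
proof (cases "U = {}")
  case False
  define n where "n = int (card U)"
  define s where "s = (\<Sum>u\<in>U. d u)"
  have npos: "n > 0" using False assms by (simp add: n_def card_gt_0_iff)
  have "0 \<le> (\<Sum>u\<in>U. (n * d u - s)\<^sup>2)" by (intro sum_nonneg) simp
  also have "\<dots> = (\<Sum>u\<in>U. n\<^sup>2 * (d u)\<^sup>2 - 2 * n * s * d u + s\<^sup>2)"
    by (intro sum.cong) (auto simp: power2_eq_square algebra_simps)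
  also have "\<dots> = n\<^sup>2 * (\<Sum>u\<in>U. (d u)\<^sup>2) - 2 * n * s * s + n * s\<^sup>2"
    by (simp add: sum.distrib sum_subtractf sum_distrib_left[symmetric] n_def s_def)
  also have "\<dots> = n * (n * (\<Sum>u\<in>U. (d u)\<^sup>2) - s\<^sup>2)"
    by (simp add: power2_eq_square algebra_simps)
  finally show ?thesis using npos
    by (simp add: zero_le_mult_iff n_def s_def)
qed auto

text \<open>
  Cauchy-Schwarz applied to the multiplicities with which the sets \<open>F i\<close> cover the points of their union.
\<close>

lemma card_UN_almost_disjoint:
  fixes F :: "'i \<Rightarrow> 'a set"
  assumes "finite I" "I \<noteq> {}"
    and finF: "\<And>i. i \<in> I \<Longrightarrow> finite (F i)"
    and cardF: "\<And>i. i \<in> I \<Longrightarrow> card (F i) = b"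
    and meet: "\<And>i j. i \<in> I \<Longrightarrow> j \<in> I \<Longrightarrow> i \<noteq> j \<Longrightarrow> card (F i \<inter> F j) \<le> h"
  shows "card I * b\<^sup>2 \<le> card (\<Union>i\<in>I. F i) * (b + (card I - 1) * h)"
proof -
  define U where "U = (\<Union>i\<in>I. F i)"
  define e where "e i u = (of_bool (u \<in> F i) :: int)" for i u
  have finU: "finite U" using assms by (auto simp: U_def)
  have sum_e: "(\<Sum>u\<in>U. e i u) = int (card (F i))" if "i \<in> I" for i
  proof -
    have "{u \<in> U. u \<in> F i} = F i" using that by (auto simp: U_def)
    then show ?thesis using finU by (simp add: e_def Int_def)
  qed
  have sum_ee: "(\<Sum>u\<in>U. e i u * e j u) = int (card (F i \<inter> F j))" if "i \<in> I" "j \<in> I" for i j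
  proof -
    have "{u \<in> U. u \<in> F i \<and> u \<in> F j} = F i \<inter> F j" using that by (auto simp: U_def)
    moreover have "(\<Sum>u\<in>U. e i u * e j u) = (\<Sum>u\<in>U. of_bool (u \<in> F i \<and> u \<in> F j))"
      by (intro sum.cong) (auto simp: e_def)
    ultimately show ?thesis using finU by (simp add: Int_def)
  qed
  have tot: "(\<Sum>u\<in>U. \<Sum>i\<in>I. e i u) = int (card I * b)"
    using sum_e cardF by (subst sum.swap) simp
  have row: "(\<Sum>j\<in>I. int (card (F i \<inter> F j))) \<le> int (b + (card I - 1) * h)" if i: "i \<in> I" for i
  proof -
    have "(\<Sum>j\<in>I - {i}. int (card (F i \<inter> F j))) \<le> (\<Sum>j\<in>I - {i}. int h)"
      using meet i by (intro sum_mono) auto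
    also have "\<dots> = int ((card I - 1) * h)" using i by simp
    finally show ?thesis
      using sum.remove[OF \<open>finite I\<close> i, of "\<lambda>j. int (card (F i \<inter> F j))"] cardF[OF i] by simp
  qed
  have "(\<Sum>u\<in>U. (\<Sum>i\<in>I. e i u)\<^sup>2) = (\<Sum>u\<in>U. \<Sum>i\<in>I. \<Sum>j\<in>I. e i u * e j u)"
    by (simp add: power2_eq_square sum_product)
  also have "\<dots> = (\<Sum>i\<in>I. \<Sum>u\<in>U. \<Sum>j\<in>I. e i u * e j u)" by (rule sum.swap)
  also have "\<dots> = (\<Sum>i\<in>I. \<Sum>j\<in>I. int (card (F i \<inter> F j)))"
  proof (intro sum.cong refl)
    fix i assume "i \<in> I"
    then show "(\<Sum>u\<in>U. \<Sum>j\<in>I. e i u * e j u) = (\<Sum>j\<in>I. int (card (F i \<inter> F j)))"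
      using sum_ee by (subst sum.swap) simp
  qed
  also have "\<dots> \<le> (\<Sum>i\<in>I. int (b + (card I - 1) * h))"
    using row by (intro sum_mono) auto
  finally have sq: "(\<Sum>u\<in>U. (\<Sum>i\<in>I. e i u)\<^sup>2) \<le> int (card I * (b + (card I - 1) * h))" by simp
  have "int ((card I * b)\<^sup>2) \<le> int (card U) * (\<Sum>u\<in>U. (\<Sum>i\<in>I. e i u)\<^sup>2)"
    using square_sum_le_card_mult_sum_squares[OF finU, of "\<lambda>u. \<Sum>i\<in>I. e i u"] tot by simp
  also have "\<dots> \<le> int (card U) * int (card I * (b + (card I - 1) * h))"
    using sq by (intro mult_left_mono) auto
  finally have "(card I * b)\<^sup>2 \<le> card U * (card I * (b + (card I - 1) * h))"
    by (metis of_nat_le_iff of_nat_mult)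
  then have "card I * (card I * b\<^sup>2) \<le> card I * (card U * (b + (card I - 1) * h))"
    by (simp add: power2_eq_square algebra_simps)
  then show ?thesis using assms(1,2) by (simp add: U_def card_gt_0_iff)
qed

section \<open>Sidon sets in a group\<close>

lemma card_le_1I: "finite X \<Longrightarrow> (\<And>u v. u \<in> X \<Longrightarrow> v \<in> X \<Longrightarrow> u = v) \<Longrightarrow> card X \<le> 1"
  unfolding One_nat_def by (rule card_le_Suc0_iff_eq[THEN iffD2]) blast+

text \<open>
  A Sidon set: every \<open>x \<noteq> 1\<close> has at most one representation \<open>a (inv b)\<close> with \<open>a, b \<in> A\<close>. The condition is
  expressed by left translates, as this is the form in which it arises for atoms.
\<close>

definition sidon :: "('a, 'b) monoid_scheme \<Rightarrow> 'a set \<Rightarrow> bool" where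
  "sidon G A \<longleftrightarrow>
     (\<forall>x \<in> carrier G. x \<noteq> \<one>\<^bsub>G\<^esub> \<longrightarrow> card (A \<inter> (x <#\<^bsub>G\<^esub> A)) \<le> 1)"

context group
begin

lemma left_cancel:
  "x \<in> carrier G \<Longrightarrow> y \<in> carrier G \<Longrightarrow> z \<in> carrier G \<Longrightarrow> x \<otimes> y = x \<otimes> z \<longleftrightarrow> y = z"
  by simp

lemma l_coset_eq_image: "x <# X = (\<lambda>y. x \<otimes> y) ` X"
  by (auto simp: l_coset_def)

lemma r_coset_eq_image: "X #> x = (\<lambda>y. y \<otimes> x) ` X"
  by (auto simp: r_coset_def)

lemma card_l_coset: "x \<in> carrier G \<Longrightarrow> X \<subseteq> carrier G \<Longrightarrow> card (x <# X) = card X"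
  unfolding l_coset_eq_image by (rule card_image) (auto simp: inj_on_def subset_iff left_cancel)

lemma card_r_coset: "x \<in> carrier G \<Longrightarrow> X \<subseteq> carrier G \<Longrightarrow> card (X #> x) = card X"
  unfolding r_coset_eq_image by (rule card_image) (auto simp: inj_on_def subset_iff)

lemma set_mult_eq_UN_l_coset: "X <#> Y = (\<Union>x\<in>X. x <# Y)"
  by (auto simp: set_mult_def l_coset_def)

lemma set_mult_eq_UN_r_coset: "X <#> Y = (\<Union>y\<in>Y. X #> y)"
  by (auto simp: set_mult_def r_coset_def)

lemma set_mult_singleton_right: "X <#> {t} = X #> t"
  by (simp add: r_coset_eq_set_mult)

lemma finite_set_mult: "finite X \<Longrightarrow> finite Y \<Longrightarrow> finite (X <#> Y)"
  by (auto simp: set_mult_def)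

lemma card_set_mult_ge_right:
  assumes "finite (carrier G)" "X \<subseteq> carrier G" "Y \<subseteq> carrier G" "X \<noteq> {}"
  shows "card Y \<le> card (X <#> Y)"
proof -
  obtain x where "x \<in> X" using assms by auto
  then have "x <# Y \<subseteq> X <#> Y" by (auto simp: set_mult_eq_UN_l_coset)
  moreover have "finite (X <#> Y)"
    using finite_subset[OF setmult_subset_G[of X Y]] assms by blast
  ultimately have "card (x <# Y) \<le> card (X <#> Y)" by (rule card_mono[rotated])
  then show ?thesis using card_l_coset[of x Y] \<open>x \<in> X\<close> assms by auto
qed

lemma sidon_left_quotient:
  assumes "finite A" "A \<subseteq> carrier G" "sidon G A"
    and "a \<in> A" "b \<in> A" "c \<in> A" "d \<in> A" "a \<otimes> inv b = c \<otimes> inv d" "a \<noteq> b"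
  shows "a = c \<and> b = d"
proof -
  define x where "x = a \<otimes> inv b"
  have car: "a \<in> carrier G" "b \<in> carrier G" "c \<in> carrier G" "d \<in> carrier G"
    using assms by auto
  have x': "x = c \<otimes> inv d" using assms(8) by (simp add: x_def)
  have "x \<otimes> d = c" unfolding x' using car by (simp add: m_assoc)
  then have x: "x \<in> carrier G" "x \<otimes> b = a" "x \<otimes> d = c"
    using car by (simp_all add: x_def m_assoc)
  moreover from x have "x \<noteq> \<one>" using assms(9) car by auto
  ultimately have x: "x \<in> carrier G" "x \<noteq> \<one>" "x \<otimes> b = a" "x \<otimes> d = c" by auto
  then have "a \<in> A \<inter> (x <# A)" "c \<in> A \<inter> (x <# A)"
    using assms by (auto simp: l_coset_def)
  moreover have "card (A \<inter> (x <# A)) \<le> 1" using assms x by (auto simp: sidon_def)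
  ultimately have ac: "a = c"
    using assms(1) card_le_Suc0_iff_eq[of "A \<inter> (x <# A)"] by simp
  then show ?thesis using x car left_cancel[of x b d] by simp
qed

text \<open>
  An equality of quotients \<open>inv a b = inv c d\<close> rearranges to \<open>a (inv c) = b (inv d)\<close>, so the condition on
  quotients of one kind gives that on the other.
\<close>

lemma sidon_right_quotient:
  assumes "finite A" "A \<subseteq> carrier G" "sidon G A"
    and "a \<in> A" "b \<in> A" "c \<in> A" "d \<in> A" "inv a \<otimes> b = inv c \<otimes> d" "a \<noteq> b"
  shows "a = c \<and> b = d"
proof -
  have car: "a \<in> carrier G" "b \<in> carrier G" "c \<in> carrier G" "d \<in> carrier G"
    using assms by auto
  have "b = a \<otimes> (inv c \<otimes> d)" using car assms(8) by (simp add: inv_solve_left')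
  then have "b \<otimes> inv d = a \<otimes> inv c" using car by (simp add: m_assoc)
  then have *: "a \<otimes> inv c = b \<otimes> inv d" by simp
  show ?thesis
  proof (cases "a = c")
    case True
    then show ?thesis using car assms(8) by (simp add: left_cancel)
  next
    case False
    then show ?thesis using sidon_left_quotient[OF assms(1-3) _ _ _ _ *] assms by auto
  qed
qed

lemma sidon_inverse:
  assumes "finite A" "A \<subseteq> carrier G" "sidon G A"
  shows "sidon G (m_inv G ` A)"
  unfolding sidon_def
proof (intro ballI impI)
  fix x assume x: "x \<in> carrier G" "x \<noteq> \<one>"
  have "u = v" if "u \<in> (m_inv G ` A) \<inter> (x <# (m_inv G ` A))"
    "v \<in> (m_inv G ` A) \<inter> (x <# (m_inv G ` A))" for u v
  proof -
    from that obtain a b c d where *: "a \<in> A" "b \<in> A" "c \<in> A" "d \<in> A"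
      "u = inv a" "u = x \<otimes> inv b" "v = inv c" "v = x \<otimes> inv d"
      by (auto simp: l_coset_def)
    have car: "a \<in> carrier G" "b \<in> carrier G" "c \<in> carrier G" "d \<in> carrier G"
      using * assms by auto
    have "x \<otimes> inv b = inv a" "x \<otimes> inv d = inv c" using * by auto
    moreover have "x \<otimes> inv b \<otimes> b = x" "x \<otimes> inv d \<otimes> d = x" using car x by (simp_all add: m_assoc)
    ultimately have "inv a \<otimes> b = x" "inv c \<otimes> d = x" by simp_all
    moreover from this have "a \<noteq> b" using x car by auto
    ultimately have "a = c" using sidon_right_quotient[OF assms *(1-4)] by simp
    then show ?thesis using *(5,7) by simp
  qed
  then show "card ((m_inv G ` A) \<inter> (x <# (m_inv G ` A))) \<le> 1"
    using assms(1) by (intro card_le_1I) (simp, metis)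
qed

lemma sidon_r_coset_meet:
  assumes "finite A" "A \<subseteq> carrier G" "sidon G A"
    and st: "s \<in> carrier G" "t \<in> carrier G" "s \<noteq> t"
  shows "card ((A #> s) \<inter> (A #> t)) \<le> 1"
proof -
  have "u = v" if "u \<in> (A #> s) \<inter> (A #> t)" "v \<in> (A #> s) \<inter> (A #> t)" for u v
  proof -
    from that obtain a b c d where *: "a \<in> A" "b \<in> A" "c \<in> A" "d \<in> A"
      "u = a \<otimes> s" "u = b \<otimes> t" "v = c \<otimes> s" "v = d \<otimes> t"
      by (auto simp: r_coset_def)
    have car: "a \<in> carrier G" "b \<in> carrier G" "c \<in> carrier G" "d \<in> carrier G"
      using * assms by auto
    have "a \<otimes> s = b \<otimes> t" "c \<otimes> s = d \<otimes> t" using * by auto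
    then have "inv b \<otimes> a \<otimes> s = t" "inv d \<otimes> c \<otimes> s = t"
      using car st by (simp_all add: m_assoc inv_solve_left')
    then have "inv b \<otimes> a = inv d \<otimes> c" using car st right_cancel[of s "inv b \<otimes> a" "inv d \<otimes> c"] by simp
    moreover have "b \<noteq> a"
    proof
      assume "b = a"
      then have "a \<otimes> s = a \<otimes> t" using *(5,6) by simp
      then show False using left_cancel[of a s t] car(1) st by blast
    qed
    ultimately have "b = d \<and> a = c" using sidon_right_quotient[OF assms(1-3) *(2,1,4,3)] by blast
    then show ?thesis using *(5,7) by simp
  qed
  then show ?thesis
    using assms(1) by (intro card_le_1I) (simp add: r_coset_eq_image, metis)
qed

section \<open>Growth under multiplication by a generating Sidon set\<close>

lemma generate_invariant_eq_carrier:
  assumes "finite (carrier G)" "A \<subseteq> carrier G" "generate G A = carrier G"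
    and X: "X \<subseteq> carrier G" "X \<noteq> {}" and inv: "\<And>a. a \<in> A \<Longrightarrow> a <# X = X"
  shows "X = carrier G"
proof -
  have *: "g <# X = X" if "g \<in> generate G A" for g
    using that
  proof (induction rule: generate.induct)
    case one
    then show ?case using X lcos_mult_one by simp
  next
    case (incl h)
    then show ?case using inv by simp
  next
    case (inv h)
    then have "h <# X = X" "h \<in> carrier G" using assms by auto
    then show ?case using lcos_m_assoc[of X "inv h" h] lcos_mult_one X by simp
  next
    case (eng g h)
    then show ?case
      using lcos_m_assoc[of X g h] X assms(2) generate_in_carrier by simp
  qed
  obtain x where x: "x \<in> X" using X by auto
  show ?thesis
  proof
    show "carrier G \<subseteq> X"
    proof
      fix g assume g: "g \<in> carrier G"
      have xc: "x \<in> carrier G" using x X by auto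
      have "(g \<otimes> inv x) <# X = X" using * assms(3) g xc by simp
      moreover have "g = (g \<otimes> inv x) \<otimes> x" using g xc by (simp add: m_assoc)
      ultimately show "g \<in> X" using x by (auto simp: l_coset_def)
    qed
  qed (use X in auto)
qed

lemma generate_inverse_image:
  assumes "A \<subseteq> carrier G"
  shows "generate G (m_inv G ` A) = generate G A"
proof
  show "generate G (m_inv G ` A) \<subseteq> generate G A"
    by (rule generate_subgroup_incl[OF _ generate_is_subgroup]) (use assms in \<open>auto intro: generate.inv\<close>)
  have "a \<in> generate G (m_inv G ` A)" if "a \<in> A" for a
    using generate.inv[of "inv a" "m_inv G ` A" G] that assms by auto
  then show "generate G A \<subseteq> generate G (m_inv G ` A)"
    by (intro generate_subgroup_incl[OF _ generate_is_subgroup]) (use assms in auto)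
qed

text \<open>Duality: a set disjoint from \<open>AX\<close> has its product with the inverses of \<open>A\<close> disjoint from \<open>X\<close>.\<close>

lemma set_mult_dual:
  assumes "A \<subseteq> carrier G" "X \<subseteq> carrier G"
  shows "(m_inv G ` A) <#> (carrier G - (A <#> X)) \<subseteq> carrier G - X"
proof
  fix z assume "z \<in> (m_inv G ` A) <#> (carrier G - (A <#> X))"
  then obtain a d where ad: "a \<in> A" "d \<in> carrier G" "d \<notin> A <#> X" "z = inv a \<otimes> d"
    by (auto simp: set_mult_def)
  then have "a \<in> carrier G" using assms by auto
  then have "a \<otimes> z = d" "z \<in> carrier G" using ad by (auto simp: m_assoc[symmetric])
  moreover have "a \<otimes> z \<in> A <#> X" if "z \<in> X" using that ad by (auto simp: set_mult_def)
  ultimately show "z \<in> carrier G - X" using ad by auto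
qed

text \<open>
  The inequality from counting incidences between \<open>AB\<close> and the sets \<open>Ab\<close>, where \<open>k = |A|\<close>, \<open>b = |B|\<close> and
  \<open>n = |AB| \<le> b + 2 k - 4\<close>. It is quadratic in \<open>b\<close> and, for \<open>k \<ge> 4\<close>, fails on the whole range
  \<open>2 \<le> b < 2 k\<close>.
\<close>

lemma sidon_incidence_arith:
  fixes k b n :: nat
  assumes "3 \<le> k" "2 \<le> b" "b < 2 * k" "n + 4 \<le> b + 2 * k" "b * k\<^sup>2 \<le> n * (k + (b - 1))"
  shows "k = 3 \<and> 4 \<le> b"
proof -
  define K where "K = int k"
  define B where "B = int b"
  have i: "int n \<le> B + 2 * K - 4" "3 \<le> K" "2 \<le> B" "B \<le> 2 * K - 1"
    using assms by (auto simp: K_def B_def)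
  have "int (b * k\<^sup>2) \<le> int (n * (k + (b - 1)))" using assms(5) by linarith
  moreover have "int (k + (b - 1)) = K + B - 1" using assms(2) by (simp add: K_def B_def)
  ultimately have "B * K\<^sup>2 \<le> int n * (K + B - 1)" by (metis B_def K_def of_nat_mult of_nat_power)
  also have "\<dots> \<le> (B + 2 * K - 4) * (K + B - 1)" using i by (intro mult_right_mono) auto
  finally have main: "B * K\<^sup>2 \<le> (B + 2 * K - 4) * (K + B - 1)" .
  have k3: "K < 4"
  proof (rule ccontr)
    assume "\<not> K < 4"
    then have 1: "0 \<le> (K - 1) * (K - 4) * (B - 2)" using i by simp
    have 2: "0 \<le> (B - 2) * (2 * K - 1 - B)" using i by simp
    \<comment> \<open>Convexity: subtracting \<open>(B - 2) (B - (2 K - 1))\<close> leaves a function linear in \<open>B\<close>.\<close>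
    have "(B + 2 * K - 4) * (K + B - 1) - B * K\<^sup>2 =
      - ((B - 2) * (2 * K - 1 - B)) - (K - 1) * (K - 4) * (B - 2) - 2"
      by (simp add: algebra_simps power2_eq_square)
    then show False using 1 2 main by linarith
  qed
  then have "K = 3" using i by simp
  moreover have "4 \<le> B"
  proof (rule ccontr)
    assume "\<not> ?thesis"
    then have "B = 2 \<or> B = 3" using i by auto
    then show False using main \<open>K = 3\<close> by auto
  qed
  ultimately show ?thesis by (simp add: K_def B_def)
qed

lemma subgroup_right_stabilizer:
  assumes "B \<subseteq> carrier G"
  shows "subgroup {u \<in> carrier G. B #> u = B} G"
proof (rule subgroupI)
  fix a assume "a \<in> {u \<in> carrier G. B #> u = B}"
  then show "inv a \<in> {u \<in> carrier G. B #> u = B}"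
    using coset_mult_assoc[of B a "inv a"] assms by auto
next
  fix a b assume "a \<in> {u \<in> carrier G. B #> u = B}" "b \<in> {u \<in> carrier G. B #> u = B}"
  then show "a \<otimes> b \<in> {u \<in> carrier G. B #> u = B}"
    using coset_mult_assoc[of B a b] assms by auto
qed (use assms in \<open>auto intro!: exI[of _ \<one>]\<close>)

text \<open>
  The extremal case: \<open>B\<close> is a 2-atom for left multiplication by \<open>A\<close>, small enough for the intersection
  property to apply.
\<close>

lemma sidon_atom_excess:
  assumes fin: "finite (carrier G)"
    and A: "A \<subseteq> carrier G" "\<one> \<in> A" "sidon G A" "3 \<le> card A"
    and gen: "generate G A = carrier G"
    and B: "B \<subseteq> carrier G" "2 \<le> card B"
    and cardAB: "card (A <#> B) = card B + c"
    and proper: "card (A <#> B) + 2 \<le> order G"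
    and large: "2 * card B + c \<le> order G"
    and iso: "\<And>U. U \<subseteq> carrier G \<Longrightarrow> 2 \<le> card U \<Longrightarrow> card (A <#> U) + 2 \<le> order G
      \<Longrightarrow> card U + c \<le> card (A <#> U)"
    and strict: "\<And>J. J \<subseteq> carrier G \<Longrightarrow> 2 \<le> card J \<Longrightarrow> card J < card B \<Longrightarrow>
      card (A <#> J) + 2 \<le> order G \<Longrightarrow> card J + c < card (A <#> J)"
  shows "2 * card A \<le> c + 3"
proof (rule ccontr)
  assume neg: "\<not> ?thesis"
  define k where "k = card A"
  define b where "b = card B"
  define n where "n = card (A <#> B)"
  have k3: "3 \<le> k" and b2: "2 \<le> b" using A B by (auto simp: k_def b_def)
  have n: "n + 4 \<le> b + 2 * k" using neg cardAB by (simp add: n_def b_def k_def)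
  have finA: "finite A" and finB: "finite B" using A B fin finite_subset by auto
  have finAB: "finite (A <#> B)" using finA finB by (rule finite_set_mult)
  have translates: "card (B \<inter> (B #> x)) \<le> 1 \<or> B = B #> x" if x: "x \<in> carrier G" for x
  proof (rule submodular_intersection[where V = "carrier G" and N = "\<lambda>X. A <#> X" and c = c])
    show "card (A <#> (B #> x)) = card B + c"
      using x A B cardAB by (simp add: setmult_rcos_assoc card_r_coset setmult_subset_G)
    show "A <#> (B \<union> (B #> x)) = (A <#> B) \<union> (A <#> (B #> x))" by (auto simp: set_mult_def)
    show "A <#> (B \<inter> (B #> x)) \<subseteq> (A <#> B) \<inter> (A <#> (B #> x))" by (auto simp: set_mult_def)
  qed (use x A B cardAB fin iso strict large in
      \<open>auto simp: setmult_subset_G card_r_coset order_def r_coset_subset_G\<close>)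
  define H where "H = {u \<in> carrier G. B #> u = B}"
  define h where "h = card H"
  have subH: "subgroup H G" unfolding H_def using B subgroup_right_stabilizer by simp
  have Hc: "H \<subseteq> carrier G" by (auto simp: H_def)
  have finH: "finite H" using Hc fin finite_subset by auto
  have BH: "p \<otimes> u \<in> B" if "p \<in> B" "u \<in> H" for p u
    using that by (auto simp: H_def r_coset_def)
  \<comment> \<open>If \<open>x p = y q\<close> and \<open>x (p u) = y (q u)\<close> lie in both translates, then \<open>B\<close> and \<open>B u\<close> share the two
    distinct points \<open>p u\<close> and \<open>q u\<close>, so \<open>u\<close> stabilises \<open>B\<close>.\<close>
  have meet: "card ((x <# B) \<inter> (y <# B)) \<le> h" if xy: "x \<in> carrier G" "y \<in> carrier G" "x \<noteq> y" for x y
  proof (cases "(x <# B) \<inter> (y <# B) = {}")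
    case False
    then obtain p q where pq: "p \<in> B" "q \<in> B" "x \<otimes> p = y \<otimes> q" by (auto simp: l_coset_def)
    have pqc: "p \<in> carrier G" "q \<in> carrier G" using pq B by auto
    have "p \<noteq> q" using pq xy pqc by (metis right_cancel)
    have "(x <# B) \<inter> (y <# B) \<subseteq> (x \<otimes> p) <# H"
    proof
      fix z assume "z \<in> (x <# B) \<inter> (y <# B)"
      then obtain r s where rs: "r \<in> B" "s \<in> B" "z = x \<otimes> r" "z = y \<otimes> s" by (auto simp: l_coset_def)
      have rsc: "r \<in> carrier G" "s \<in> carrier G" using rs B by auto
      define u where "u = inv p \<otimes> r"
      have u: "u \<in> carrier G" "p \<otimes> u = r" using pqc rsc by (auto simp: u_def m_assoc[symmetric])
      have "y \<otimes> (q \<otimes> u) = (x \<otimes> p) \<otimes> u" using pq pqc xy u by (simp add: m_assoc)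
      also have "\<dots> = y \<otimes> s" using u rs pqc xy by (simp add: m_assoc)
      finally have "q \<otimes> u = s" using pqc u xy rsc by (simp add: left_cancel)
      then have "r \<in> B \<inter> (B #> u)" "s \<in> B \<inter> (B #> u)" "r \<noteq> s"
        using rs pq u pqc \<open>p \<noteq> q\<close> by (auto simp: r_coset_def)
      then have "\<not> card (B \<inter> (B #> u)) \<le> 1"
        using finB by (metis One_nat_def card_le_Suc0_iff_eq finite_Int)
      then have "u \<in> H" using translates u by (auto simp: H_def)
      moreover have "z = (x \<otimes> p) \<otimes> u" using u rs pqc xy by (simp add: m_assoc)
      ultimately show "z \<in> (x \<otimes> p) <# H" by (auto simp: l_coset_def)
    qed
    then have "card ((x <# B) \<inter> (y <# B)) \<le> card ((x \<otimes> p) <# H)"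
      using finH by (intro card_mono) (auto simp: l_coset_eq_image)
    then show ?thesis using card_l_coset[of "x \<otimes> p" H] Hc xy pqc by (simp add: h_def)
  qed simp
  have left: "k * b\<^sup>2 \<le> n * (b + (k - 1) * h)"
    unfolding k_def n_def set_mult_eq_UN_l_coset
  proof (rule card_UN_almost_disjoint)
    show "card (a <# B) = b" if "a \<in> A" for a using that A B by (auto simp: b_def card_l_coset)
    show "card ((x <# B) \<inter> (y <# B)) \<le> h" if "x \<in> A" "y \<in> A" "x \<noteq> y" for x y
      using meet that A by blast
  qed (use A finA finB in \<open>auto simp: l_coset_eq_image\<close>)
  have right: "b * k\<^sup>2 \<le> n * (k + (b - 1))"
  proof -
    have "card B * k\<^sup>2 \<le> card (\<Union>s\<in>B. A #> s) * (k + (card B - 1) * 1)"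
    proof (rule card_UN_almost_disjoint)
      show "card (A #> s) = k" if "s \<in> B" for s using that A B by (auto simp: k_def card_r_coset)
      show "card ((A #> s) \<inter> (A #> t)) \<le> 1" if "s \<in> B" "t \<in> B" "s \<noteq> t" for s t
        using sidon_r_coset_meet[OF finA A(1,3)] that B by blast
    qed (use B finA finB in \<open>auto simp: r_coset_eq_image\<close>)
    then show ?thesis by (simp add: n_def b_def set_mult_eq_UN_r_coset)
  qed
  note arith = sidon_incidence_arith[OF k3 b2 _ n right]
  obtain p where p: "p \<in> B" using b2 by (fastforce simp: b_def)
  then have pc: "p \<in> carrier G" using B by auto
  have cosetB: "q <# H \<subseteq> B" if "q \<in> B" for q using BH that by (auto simp: l_coset_def)
  have card_coset: "card (q <# H) = h" if "q \<in> B" for q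
    using that B Hc by (auto simp: h_def card_l_coset)
  show False
  proof (cases "h = b")
    case True
    have cosetB_eq: "q <# H = B" if "q \<in> B" for q
      using card_subset_eq[OF finB cosetB[OF that]] card_coset[OF that] True by (simp add: b_def)
    have "a <# B = B" if a: "a \<in> A" for a
    proof (rule ccontr)
      assume ne: "a <# B \<noteq> B"
      have ac: "a \<in> carrier G" using a A by auto
      have "(a <# B) \<inter> B = {}"
      proof (rule ccontr)
        assume "\<not> ?thesis"
        then obtain q where q: "q \<in> B" "a \<otimes> q \<in> B" by (auto simp: l_coset_def)
        have "a <# B = a <# (q <# H)" using cosetB_eq q by simp
        also have "\<dots> = (a \<otimes> q) <# H" using lcos_m_assoc[OF Hc ac] q B by auto
        also have "\<dots> = B" using cosetB_eq q by simp
        finally show False using ne by simp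
      qed
      moreover have "card (a <# B) = b" using card_l_coset ac B by (simp add: b_def)
      ultimately have "card ((a <# B) \<union> B) = 2 * b"
        using finB by (simp add: card_Un_disjoint l_coset_eq_image b_def)
      moreover have "(a <# B) \<union> B \<subseteq> A <#> B"
        using a A B by (force simp: set_mult_def l_coset_def)
      ultimately have "2 * b \<le> n" using card_mono[OF finAB] by (metis n_def)
      then show False using n arith by auto
    qed
    then have "B = carrier G"
      using generate_invariant_eq_carrier[OF fin A(1) gen B(1)] p by auto
    moreover have "B \<subseteq> A <#> B" using A B by (force simp: set_mult_def)
    ultimately show False using proper card_mono[OF finAB, of B] by (simp add: order_def)
  next
    case False
    then have "p <# H \<noteq> B" using card_coset[OF p] by (auto simp: b_def)
    then obtain q where q: "q \<in> B" "q \<notin> p <# H" using cosetB[OF p] by blast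
    have "(p <# H) \<inter> (q <# H) = {}"
    proof (rule ccontr)
      assume "\<not> ?thesis"
      then obtain u v where uv: "u \<in> H" "v \<in> H" "p \<otimes> u = q \<otimes> v" by (auto simp: l_coset_def)
      have "q \<in> carrier G" "u \<in> carrier G" "v \<in> carrier G" using q B uv Hc by auto
      then have "q = p \<otimes> (u \<otimes> inv v)" using uv pc by (metis inv_closed inv_solve_right m_assoc m_closed)
      moreover have "u \<otimes> inv v \<in> H" using uv subH by (simp add: subgroup_def)
      ultimately show False using q by (auto simp: l_coset_def)
    qed
    then have "card ((p <# H) \<union> (q <# H)) = 2 * h"
      using card_coset p q finH by (simp add: card_Un_disjoint l_coset_eq_image)
    moreover have "(p <# H) \<union> (q <# H) \<subseteq> B" using cosetB p q by auto
    ultimately have h2: "2 * h \<le> b" using card_mono[OF finB] by (metis b_def)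
    \<comment> \<open>With \<open>2 h \<le> b\<close>, counting incidences with the sets \<open>aB\<close> bounds \<open>b\<close> from above.\<close>
    have "b * (2 * k * b) \<le> 2 * (n * (b + (k - 1) * h))"
      using left by (simp add: power2_eq_square algebra_simps)
    also have "\<dots> = n * (2 * b + (k - 1) * (2 * h))" by (simp add: algebra_simps)
    also have "\<dots> \<le> n * (2 * b + (k - 1) * b)" using h2 by (intro mult_left_mono add_left_mono) auto
    also have "\<dots> = b * (n * (k + 1))"
      using k3 by (cases k) (auto simp: algebra_simps)
    finally have l2: "2 * k * b \<le> n * (k + 1)" using b2 by simp
    have l3: "int b * (int k - 1) \<le> (2 * int k - 4) * (int k + 1)"
    proof -
      have "int (2 * k * b) \<le> int (n * (k + 1))" using l2 by linarith
      also have "\<dots> \<le> (int b + 2 * int k - 4) * (int k + 1)"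
        using n unfolding of_nat_mult by (intro mult_mono) auto
      finally show ?thesis by (simp add: algebra_simps)
    qed
    have "b < 2 * k"
    proof (rule ccontr)
      assume "\<not> ?thesis"
      then have "2 * int k * (int k - 1) \<le> int b * (int k - 1)" using k3 by (intro mult_right_mono) auto
      then show False using l3 by (simp add: algebra_simps)
    qed
    from arith[OF this] have k: "k = 3" and b: "4 \<le> b" by auto
    \<comment> \<open>The exceptional case that counting alone does not exclude: all estimates are tight.\<close>
    have b4: "b = 4" using l3 k b by simp
    have n6: "n \<le> 6" using n k b4 by simp
    have h_2: "h = 2"
    proof -
      have "48 \<le> n * (4 + 2 * h)" using left k b4 by simp
      also have "\<dots> \<le> 6 * (4 + 2 * h)" using n6 by (rule mult_right_mono) simp
      finally show ?thesis using h2 b4 by simp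
    qed
    have oneH: "\<one> \<in> H" using subH by (rule subgroup.one_closed)
    then have "card (H - {\<one>}) = 1" using h_2 finH by (simp add: h_def)
    then obtain t where "H - {\<one>} = {t}" by (auto simp: card_1_singleton_iff)
    then have t: "H = {\<one>, t}" "t \<noteq> \<one>" using oneH by auto
    have tc: "t \<in> carrier G" using t Hc by auto
    have "t \<otimes> t \<in> H" using subH t by (auto simp: subgroup_def)
    then have tt: "t \<otimes> t = \<one>" using t tc by auto
    define r where "r = p \<otimes> t"
    have r: "r \<in> B" "r \<in> carrier G" using BH[OF p, of t] t B by (auto simp: r_def)
    \<comment> \<open>A common point \<open>a p = d p t\<close> would make \<open>inv a d\<close> a conjugate of the involution \<open>t\<close>, hence equal
      to its inverse \<open>inv d a\<close>.\<close>
    have disj: "(A #> p) \<inter> (A #> r) = {}"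
    proof (rule ccontr)
      assume "\<not> ?thesis"
      then obtain a d where ad: "a \<in> A" "d \<in> A" "a \<otimes> p = d \<otimes> (p \<otimes> t)"
        by (auto simp: r_coset_def r_def)
      have adc: "a \<in> carrier G" "d \<in> carrier G" using ad A by auto
      have "d \<otimes> p = (a \<otimes> p) \<otimes> t"
        using ad(3) adc pc tc tt by (simp add: m_assoc)
      then have *: "inv a \<otimes> d \<otimes> p = p \<otimes> t"
        using adc pc tc by (metis inv_closed inv_solve_left m_assoc m_closed)
      have "inv d \<otimes> a \<otimes> p = p \<otimes> t"
        using ad(3) adc pc tc by (metis inv_closed inv_solve_left m_assoc m_closed)
      with * have eq: "inv a \<otimes> d = inv d \<otimes> a" using adc pc by (metis inv_closed m_closed right_cancel)
      have "a \<noteq> d"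
      proof
        assume "a = d"
        then have "p = p \<otimes> t" using ad(3) adc pc tc by (simp add: left_cancel)
        then show False using t pc tc by simp
      qed
      then show False using sidon_right_quotient[OF finA A(1,3) ad(1,2,2,1) eq] by simp
    qed
    have "card (A #> p) = 3" "card (A #> r) = 3" "card (A #> q) = 3"
      using card_r_coset A pc r q B k by (auto simp: k_def)
    note cc = this
    have "card ((A #> q) \<inter> (A #> p)) \<le> 1" "card ((A #> q) \<inter> (A #> r)) \<le> 1"
    proof -
      have "q \<noteq> p" "q \<noteq> r" using q t pc by (auto simp: l_coset_def r_def)
      then show "card ((A #> q) \<inter> (A #> p)) \<le> 1" "card ((A #> q) \<inter> (A #> r)) \<le> 1"
        using sidon_r_coset_meet[OF finA A(1,3)] pc r q B by blast+
    qed
    moreover have "(A #> q) \<inter> ((A #> p) \<union> (A #> r)) = ((A #> q) \<inter> (A #> p)) \<union> ((A #> q) \<inter> (A #> r))"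
      by blast
    ultimately have m: "card ((A #> q) \<inter> ((A #> p) \<union> (A #> r))) \<le> 2"
      using card_Un_le[of "(A #> q) \<inter> (A #> p)" "(A #> q) \<inter> (A #> r)"] by simp
    have f: "finite (A #> x)" for x using finA by (simp add: r_coset_eq_image)
    have "card ((A #> p) \<union> (A #> r)) = 6" using disj cc f by (simp add: card_Un_disjoint)
    then have "7 \<le> card ((A #> q) \<union> ((A #> p) \<union> (A #> r)))"
      using card_Un_Int[of "A #> q" "(A #> p) \<union> (A #> r)"] m cc f by simp
    moreover have "(A #> q) \<union> ((A #> p) \<union> (A #> r)) \<subseteq> A <#> B"
      using p r q by (auto simp: set_mult_eq_UN_r_coset)
    ultimately have "7 \<le> n" unfolding n_def using card_mono[OF finAB] le_trans by blast
    then show False using n6 by simp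
  qed
qed

text \<open>
  Reduction to the extremal case. Minimising over \<open>A\<close> and its set of inverses \<open>A'\<close> simultaneously ensures
  that the dual \<open>D\<close> of the minimiser \<open>B\<close> is at least as large as \<open>B\<close>, so that \<open>|G| \<ge> 2|B| + c\<close>.
\<close>

lemma sidon_generating_excess:
  assumes fin: "finite (carrier G)"
    and A: "A \<subseteq> carrier G" "\<one> \<in> A" "sidon G A" "3 \<le> card A"
    and gen: "generate G A = carrier G"
    and Y: "Y \<subseteq> carrier G" "2 \<le> card Y" "card (A <#> Y) + 2 \<le> order G"
  shows "card Y + 2 * card A \<le> card (A <#> Y) + 3"
proof -
  define A' where "A' = m_inv G ` A"
  have finA: "finite A" using A fin finite_subset by auto
  have A': "A' \<subseteq> carrier G" "\<one> \<in> A'" "sidon G A'" "card A' = card A" "generate G A' = carrier G"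
    "m_inv G ` A' = A"
  proof -
    show "card A' = card A" unfolding A'_def
      using A inv_inj by (intro card_image) (rule inj_on_subset)
    show "\<one> \<in> A'" using A by (force simp: A'_def)
    show "m_inv G ` A' = A" using A by (force simp: A'_def image_image subset_iff)
    show "generate G A' = carrier G" using generate_inverse_image gen A by (simp add: A'_def)
  qed (use A sidon_inverse[OF finA] in \<open>auto simp: A'_def\<close>)
  define adm where "adm M X \<longleftrightarrow> X \<subseteq> carrier G \<and> 2 \<le> card X \<and> card (M <#> X) + 2 \<le> order G" for M X
  define P where "P c \<longleftrightarrow> (\<exists>M\<in>{A, A'}. \<exists>X. adm M X \<and> card (M <#> X) = card X + c)" for c
  have M: "M \<subseteq> carrier G \<and> \<one> \<in> M \<and> sidon G M \<and> card M = card A \<and> generate G M = carrier G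
      \<and> m_inv G ` M \<in> {A, A'}" if "M \<in> {A, A'}" for M
  proof (cases "M = A")
    case True
    then show ?thesis using A gen A'_def by blast
  next
    case False
    then have "M = A'" using that by blast
    then show ?thesis using A' by blast
  qed
  have ge: "card X \<le> card (M <#> X)" if "M \<in> {A, A'}" "X \<subseteq> carrier G" for M X
    using card_set_mult_ge_right[OF fin] M[OF that(1)] that(2) by blast
  have ex: "\<exists>c. card (M <#> X) = card X + c \<and> P c" if "M \<in> {A, A'}" "adm M X" for M X
  proof -
    have "card (M <#> X) = card X + (card (M <#> X) - card X)" using ge that by (simp add: adm_def)
    then show ?thesis using that by (auto simp: P_def)
  qed
  define c where "c = (LEAST c. P c)"
  have Pc: "P c" unfolding c_def using ex[of A Y] Y by (auto simp: adm_def intro: LeastI)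
  have least_c: "c \<le> c'" if "P c'" for c' using that by (simp add: c_def Least_le)
  have iso: "card X + c \<le> card (M <#> X)" if "M \<in> {A, A'}" "adm M X" for M X
    using ex[OF that] least_c by auto
  define Q where "Q b \<longleftrightarrow> (\<exists>M\<in>{A, A'}. \<exists>X. adm M X \<and> card X = b \<and> card (M <#> X) = card X + c)" for b
  define b where "b = (LEAST b. Q b)"
  have "\<exists>b. Q b" using Pc by (auto simp: P_def Q_def)
  then have "Q b" unfolding b_def by (rule LeastI_ex)
  then obtain M B where MB: "M \<in> {A, A'}" "adm M B" "card B = b" "card (M <#> B) = card B + c"
    by (auto simp: Q_def)
  have least_b: "b \<le> b'" if "Q b'" for b' using that by (simp add: b_def Least_le)
  define D where "D = carrier G - (M <#> B)"
  have MBc: "M <#> B \<subseteq> carrier G" "B \<subseteq> carrier G" "M \<subseteq> carrier G"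
    using M[OF MB(1)] MB setmult_subset_G by (auto simp: adm_def)
  have cardD: "card D + (card B + c) = order G"
    using MB(4) MBc fin card_mono[OF fin MBc(1)] finite_subset[OF MBc(1) fin]
    by (simp add: D_def order_def card_Diff_subset)
  have "(m_inv G ` M) <#> D \<subseteq> carrier G - B" unfolding D_def using set_mult_dual MBc by simp
  then have "card ((m_inv G ` M) <#> D) \<le> card (carrier G - B)"
    using fin by (intro card_mono) auto
  also have "\<dots> + card B = order G"
    using fin MBc card_mono[OF fin MBc(2)] finite_subset[OF MBc(2) fin]
    by (simp add: order_def card_Diff_subset)
  finally have dual: "card ((m_inv G ` M) <#> D) + card B \<le> order G" by simp
  have M': "m_inv G ` M \<in> {A, A'}" using M[OF MB(1)] by simp
  have "adm (m_inv G ` M) D"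
    using dual cardD MB by (auto simp: adm_def D_def)
  moreover from iso[OF M' this] have "card ((m_inv G ` M) <#> D) = card D + c" using dual cardD by simp
  ultimately have "Q (card D)" using M' by (auto simp: Q_def)
  then have "b \<le> card D" by (rule least_b)
  then have large: "2 * card B + c \<le> order G" using cardD MB by simp
  have "2 * card M \<le> c + 3"
  proof (rule sidon_atom_excess[OF fin, of M B])
    show "card J + c < card (M <#> J)" if "J \<subseteq> carrier G" "2 \<le> card J" "card J < card B"
      "card (M <#> J) + 2 \<le> order G" for J
    proof -
      have J: "adm M J" using that by (simp add: adm_def)
      have "card (M <#> J) \<noteq> card J + c"
        using least_b[of "card J"] MB J that by (auto simp: Q_def)
      then show ?thesis using iso[OF MB(1) J] by simp
    qed
  qed (use M[OF MB(1)] MB large iso[OF MB(1)] A in \<open>auto simp: adm_def\<close>)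
  then have "2 * card A \<le> c + 3" using M[OF MB(1)] by simp
  moreover have "card Y + c \<le> card (A <#> Y)" using iso[of A Y] Y by (simp add: adm_def)
  ultimately show ?thesis by simp
qed

section \<open>Decomposition along right cosets of the generated subgroup\<close>

text \<open>The growth estimate in the subgroup generated by \<open>A\<close>, carried over to a right coset by translation.\<close>

lemma sidon_coset_excess:
  assumes fin: "finite (carrier G)"
    and A: "A \<subseteq> carrier G" "\<one> \<in> A" "sidon G A" "3 \<le> card A"
    and x: "x \<in> carrier G" and T: "T \<subseteq> generate G A #> x" "2 \<le> card T"
      "2 \<le> card ((generate G A #> x) - (A <#> T))"
  shows "card T + 2 * card A \<le> card (A <#> T) + 3"
proof -
  define H where "H = generate G A"
  have sub: "subgroup H G" using generate_is_subgroup A by (simp add: H_def)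
  have Hc: "H \<subseteq> carrier G" using sub by (rule subgroup.subset)
  have AH: "A \<subseteq> H" by (auto simp: H_def intro: generate.incl)
  let ?K = "G\<lparr>carrier := H\<rparr>"
  interpret K: group ?K by (rule subgroup.subgroup_is_group[OF sub is_group])
  define Y where "Y = T #> inv x"
  have Tc: "T \<subseteq> carrier G" using T(1) r_coset_subset_G[OF Hc x] by (auto simp: H_def)
  have HxI: "(H #> x) #> inv x = H" using coset_mult_assoc[OF Hc x] x Hc by simp
  have YH: "Y \<subseteq> H"
  proof -
    have "Y \<subseteq> (H #> x) #> inv x" using T(1) by (auto simp: Y_def r_coset_def H_def)
    then show ?thesis using HxI by simp
  qed
  have cY: "card Y = card T" using card_r_coset x Tc by (simp add: Y_def)
  have ATc: "A <#> T \<subseteq> carrier G" using A Tc setmult_subset_G by simp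
  have AY: "A <#> Y = (A <#> T) #> inv x" using setmult_rcos_assoc A Tc x by (simp add: Y_def)
  then have cAY: "card (A <#> Y) = card (A <#> T)" using card_r_coset x ATc by simp
  have finH: "finite H" using Hc fin finite_subset by auto
  have ATsub: "A <#> T \<subseteq> H #> x"
  proof -
    have "A <#> T \<subseteq> H <#> (H #> x)" using AH T(1) by (auto simp: set_mult_def H_def)
    also have "\<dots> = H #> x" using setmult_rcos_assoc[OF Hc Hc x] subgroup_mult_id[OF sub] by simp
    finally show ?thesis .
  qed
  have "card (A <#> T) + 2 \<le> card (H #> x)"
    using T(3) ATsub finH card_mono[of "H #> x" "A <#> T"]
    by (simp add: H_def[symmetric] card_Diff_subset r_coset_eq_image finite_subset)
  also have "\<dots> = order ?K" using card_r_coset x Hc by (simp add: order_def)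
  finally have proper: "card (A <#> Y) + 2 \<le> order ?K" using cAY by simp
  have "card Y + 2 * card A \<le> card (A <#>\<^bsub>?K\<^esub> Y) + 3"
  proof (rule K.sidon_generating_excess)
    show "sidon ?K A" using A(3) Hc by (auto simp: sidon_def)
    show "generate ?K A = carrier ?K" using generate_consistent[OF AH sub] by (simp add: H_def)
  qed (use finH AH A YH cY T proper in auto)
  then show ?thesis using cY cAY by simp
qed

text \<open>
  A weaker estimate without the size conditions. The two cases not covered above, a single point in \<open>T\<close>
  and a single point of the coset missed by \<open>AT\<close>, are dual to each other.
\<close>

lemma sidon_coset_excess_weak:
  assumes fin: "finite (carrier G)"
    and A: "A \<subseteq> carrier G" "\<one> \<in> A" "sidon G A" "3 \<le> card A"
    and x: "x \<in> carrier G" and T: "T \<subseteq> generate G A #> x" "T \<noteq> {}"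
    and sub: "A <#> T \<subset> generate G A #> x"
  shows "card T + card A \<le> card (A <#> T) + 1"
proof -
  define H where "H = generate G A"
  have subH: "subgroup H G" using generate_is_subgroup A by (simp add: H_def)
  have Hc: "H \<subseteq> carrier G" using subH by (rule subgroup.subset)
  have Qc: "H #> x \<subseteq> carrier G" using r_coset_subset_G[OF Hc x] .
  have finQ: "finite (H #> x)" using Qc fin finite_subset by auto
  have Tc: "T \<subseteq> carrier G" using T(1) Qc by (auto simp: H_def)
  have finT: "finite T" using Tc fin finite_subset by auto
  have finA: "finite A" using A fin finite_subset by auto
  have cQ: "card (A <#> T) + card ((H #> x) - (A <#> T)) = card (H #> x)"
    using sub finQ card_mono[OF finQ, of "A <#> T"] finite_set_mult[OF finA finT]
    by (simp add: H_def[symmetric] card_Diff_subset less_imp_le)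
  consider "card T = 1" | "2 \<le> card T" "2 \<le> card ((H #> x) - (A <#> T))"
    | "card ((H #> x) - (A <#> T)) \<le> 1"
    using T(2) finT by (cases "card T") (auto, linarith)
  then show ?thesis
  proof cases
    case 1
    then obtain t where "T = {t}" by (auto simp: card_1_singleton_iff)
    then show ?thesis using card_r_coset[of t A] A Tc by (simp add: set_mult_singleton_right)
  next
    case 2
    then show ?thesis using sidon_coset_excess[OF fin A x T(1)] A by (simp add: H_def)
  next
    case 3
    \<comment> \<open>The \<open>|A|\<close> points \<open>inv a y\<close>, where \<open>y\<close> is the only point of the coset missed by \<open>AT\<close>, are outside \<open>T\<close>.\<close>
    obtain y where y: "y \<in> H #> x" "y \<notin> A <#> T" using sub by (auto simp: H_def)
    define W where "W = (m_inv G ` A) #> y"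
    have yc: "y \<in> carrier G" using y Qc by auto
    have "(m_inv G ` A) \<subseteq> carrier G" using A by auto
    moreover have "card (m_inv G ` A) = card A"
      using A inv_inj by (intro card_image) (rule inj_on_subset)
    ultimately have cW: "card W = card A" using card_r_coset yc by (simp add: W_def)
    have WT: "W \<inter> T = {}"
    proof (rule ccontr)
      assume "\<not> ?thesis"
      then obtain a where a: "a \<in> A" "inv a \<otimes> y \<in> T" by (auto simp: W_def r_coset_def)
      then have "a \<otimes> (inv a \<otimes> y) \<in> A <#> T" by (auto simp: set_mult_def)
      moreover have "a \<otimes> (inv a \<otimes> y) = y" using a A yc by (auto simp: m_assoc[symmetric])
      ultimately show False using y by simp
    qed
    obtain h where h: "h \<in> H" "y = h \<otimes> x" using y by (auto simp: r_coset_def)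
    have "W \<subseteq> H #> x"
    proof
      fix w assume "w \<in> W"
      then obtain a where a: "a \<in> A" "w = inv a \<otimes> y" by (auto simp: W_def r_coset_def)
      have "inv a \<in> H" using a by (auto simp: H_def intro: generate.inv)
      then have "inv a \<otimes> h \<in> H" using h subH by (simp add: subgroup_def)
      moreover have "w = (inv a \<otimes> h) \<otimes> x"
      proof -
        have "inv a \<in> carrier G" "h \<in> carrier G" using a h A Hc by auto
        then show ?thesis using a h x by (simp add: m_assoc)
      qed
      ultimately show "w \<in> H #> x" by (auto simp: r_coset_def)
    qed
    then have "card (W \<union> T) \<le> card (H #> x)" using T(1) finQ by (intro card_mono) (auto simp: H_def)
    moreover have "card (W \<union> T) = card W + card T"
      using WT finA finT by (simp add: W_def r_coset_eq_image card_Un_disjoint)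
    ultimately show ?thesis using cW cQ 3 by linarith
  qed
qed

text \<open>
  If \<open>AS \<noteq> HS\<close>, then some right coset of \<open>H\<close> meeting \<open>S\<close> is not filled by the corresponding part of
  \<open>AS\<close>, and it can be split off from \<open>S\<close>, \<open>AS\<close> and \<open>HS\<close>.
\<close>

lemma coset_split:
  assumes fin: "finite (carrier G)" and H: "subgroup H G" and A: "A \<subseteq> H"
    and S: "S \<subseteq> carrier G" and ne: "A <#> S \<noteq> H <#> S"
  obtains s where "s \<in> S" "S \<inter> (H #> s) \<noteq> {}" "A <#> (S \<inter> (H #> s)) \<subset> H #> s"
    "card S = card (S \<inter> (H #> s)) + card (S - (H #> s))"
    "card (A <#> S) = card (A <#> (S \<inter> (H #> s))) + card (A <#> (S - (H #> s)))"
    "H <#> S = (H #> s) \<union> (H <#> (S - (H #> s)))"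
    "(H #> s) \<inter> (H <#> (S - (H #> s))) = {}"
proof -
  have "A <#> S \<subseteq> H <#> S" using A by (auto simp: set_mult_def)
  then obtain y where y: "y \<in> H <#> S" "y \<notin> A <#> S" using ne by auto
  then obtain h s where hs: "h \<in> H" "s \<in> S" "y = h \<otimes> s" by (auto simp: set_mult_def)
  define Q where "Q = H #> s"
  have sc: "s \<in> carrier G" using hs S by auto
  have Hc: "H \<subseteq> carrier G" using H by (rule subgroup.subset)
  have Ac: "A \<subseteq> carrier G" using A Hc by auto
  have HQ: "g \<otimes> q \<in> Q" if "g \<in> H" "q \<in> Q" for g q
  proof -
    from that obtain g' where g': "g' \<in> H" "q = g' \<otimes> s" by (auto simp: Q_def r_coset_def)
    have "g \<otimes> q = (g \<otimes> g') \<otimes> s" "g \<otimes> g' \<in> H"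
      using g' that Hc sc H by (auto simp: m_assoc subset_iff subgroup_def)
    then show ?thesis by (auto simp: Q_def r_coset_def)
  qed
  have Qc: "Q \<subseteq> carrier G" using r_coset_subset_G[OF Hc sc] by (simp add: Q_def)
  have HQ': "q \<in> Q" if "g \<in> H" "q \<in> carrier G" "g \<otimes> q \<in> Q" for g q
  proof -
    have "inv g \<in> H" using that H by (simp add: subgroup.m_inv_closed)
    then have "inv g \<otimes> (g \<otimes> q) \<in> Q" using HQ that by blast
    moreover have "inv g \<otimes> (g \<otimes> q) = q" using that Hc by (auto simp: m_assoc[symmetric])
    ultimately show ?thesis by simp
  qed
  have sQ: "s \<in> Q" using hs sc H by (force simp: Q_def r_coset_def dest: subgroup.one_closed)
  have yQ: "y \<in> Q" using hs by (auto simp: Q_def r_coset_def)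
  have AT: "A <#> (S \<inter> Q) \<subseteq> Q" using HQ A by (auto simp: set_mult_def)
  have AS': "(H <#> (S - Q)) \<inter> Q = {}" using HQ' S by (auto simp: set_mult_def)
  have AS'': "(A <#> (S - Q)) \<inter> Q = {}" using AS' A by (auto simp: set_mult_def)
  have fS: "finite S" using S fin finite_subset by auto
  have fA: "finite A" using Ac fin finite_subset by auto
  show thesis
  proof (rule that[of s]; (fold Q_def)?)
    show "s \<in> S" using hs by simp
    show "S \<inter> Q \<noteq> {}" using hs sQ by auto
    show "A <#> (S \<inter> Q) \<subset> Q"
    proof -
      have "A <#> (S \<inter> Q) \<subseteq> A <#> S" by (auto simp: set_mult_def)
      then show ?thesis using AT y yQ by blast
    qed
    show "card S = card (S \<inter> Q) + card (S - Q)" using fS by (metis card_Int_Diff)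
    have "A <#> S = (A <#> (S \<inter> Q)) \<union> (A <#> (S - Q))" by (auto simp: set_mult_def)
    moreover have "(A <#> (S \<inter> Q)) \<inter> (A <#> (S - Q)) = {}" using AT AS'' by blast
    ultimately show "card (A <#> S) = card (A <#> (S \<inter> Q)) + card (A <#> (S - Q))"
      using fS fA by (simp add: card_Un_disjoint finite_set_mult)
    have "H <#> S = (H <#> (S \<inter> Q)) \<union> (H <#> (S - Q))" by (auto simp: set_mult_def)
    moreover have "H <#> (S \<inter> Q) = Q"
    proof
      show "H <#> (S \<inter> Q) \<subseteq> Q" using HQ by (auto simp: set_mult_def)
      show "Q \<subseteq> H <#> (S \<inter> Q)" using hs sQ by (auto simp: set_mult_def r_coset_def Q_def)
    qed
    ultimately show "H <#> S = Q \<union> (H <#> (S - Q))" by simp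
    show "Q \<inter> (H <#> (S - Q)) = {}" using AS' by auto
  qed
qed

section \<open>The bound for atoms that are not left-periodic\<close>

text \<open>
  The bound for a Sidon set \<open>A\<close> containing \<open>1\<close>, with the properties of a 2-atom given by \<open>iso\<close> and
  \<open>strict\<close>.
\<close>

lemma sidon_two_atom_bound:
  assumes fin: "finite (carrier G)" and S: "S \<subseteq> carrier G"
    and A: "A \<subseteq> carrier G" "\<one> \<in> A" "sidon G A" "3 \<le> card A"
    and nsub: "\<not> subgroup A G"
    and cardAS: "card (A <#> S) = card A + \<kappa>"
    and proper: "card (A <#> S) + 2 \<le> order G"
    and iso: "\<And>U. U \<subseteq> carrier G \<Longrightarrow> 2 \<le> card U \<Longrightarrow> card (U <#> S) + 2 \<le> order G
      \<Longrightarrow> card U + \<kappa> \<le> card (U <#> S)"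
    and strict: "\<And>J. J \<subseteq> carrier G \<Longrightarrow> 2 \<le> card J \<Longrightarrow> card J < card A \<Longrightarrow>
      card (J <#> S) + 2 \<le> order G \<Longrightarrow> card J + \<kappa> < card (J <#> S)"
  shows "card A + card S \<le> \<kappa> + 3"
proof (rule ccontr)
  assume "\<not> ?thesis"
  then have neg: "card (A <#> S) + 3 < 2 * card A + card S" using cardAS by simp
  define H where "H = generate G A"
  have H: "subgroup H G" using generate_is_subgroup A by (simp add: H_def)
  have Hc: "H \<subseteq> carrier G" using H by (rule subgroup.subset)
  have AH: "A \<subseteq> H" by (auto simp: H_def intro: generate.incl)
  have finH: "finite H" and finA: "finite A" and finS: "finite S"
    using finite_subset[OF _ fin] Hc A(1) S by blast+
  have kH: "card A \<le> card H" using AH finH by (rule card_mono[rotated])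
  have neAS: "A <#> S \<noteq> H <#> S"
  proof
    assume "A <#> S = H <#> S"
    then have "card H + \<kappa> \<le> card A + \<kappa>" using iso[OF Hc] kH A cardAS proper by simp
    then have "A = H" using card_seteq[OF finH AH] by simp
    then show False using nsub H by simp
  qed
  obtain s where s: "s \<in> S" "S \<inter> (H #> s) \<noteq> {}" "A <#> (S \<inter> (H #> s)) \<subset> H #> s"
    "card S = card (S \<inter> (H #> s)) + card (S - (H #> s))"
    "card (A <#> S) = card (A <#> (S \<inter> (H #> s))) + card (A <#> (S - (H #> s)))"
    "H <#> S = (H #> s) \<union> (H <#> (S - (H #> s)))"
    "(H #> s) \<inter> (H <#> (S - (H #> s))) = {}"
    using coset_split[OF fin H AH S neAS] by metis
  define Q where "Q = H #> s"
  define T where "T = S \<inter> Q"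
  define S' where "S' = S - Q"
  note s = s[folded Q_def, folded T_def S'_def]
  have sc: "s \<in> carrier G" using s(1) S by auto
  have S'c: "S' \<subseteq> carrier G" using S by (auto simp: S'_def)
  have TQ: "T \<subseteq> Q" by (simp add: T_def)
  have finT: "finite T" using finS by (simp add: T_def)
  have Ane: "A \<noteq> {}" using A by auto
  have cardQ: "card Q = card H" using card_r_coset sc Hc by (simp add: Q_def)
  have Qc: "Q \<subseteq> carrier G" using r_coset_subset_G[OF Hc sc] by (simp add: Q_def)
  have finQ: "finite Q" using Qc fin finite_subset by auto
  have eT: "card T + card A \<le> card (A <#> T) + 1"
    using sidon_coset_excess_weak[OF fin A sc, of T] s TQ by (simp add: Q_def H_def)
  \<comment> \<open>Two unfilled cosets would contribute at least \<open>2 (|A| - 1)\<close> to \<open>|AS| - |S|\<close>.\<close>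
  have full: "A <#> S' = H <#> S'"
  proof (rule ccontr)
    assume ne: "A <#> S' \<noteq> H <#> S'"
    obtain r where r: "r \<in> S'" "S' \<inter> (H #> r) \<noteq> {}" "A <#> (S' \<inter> (H #> r)) \<subset> H #> r"
      "card S' = card (S' \<inter> (H #> r)) + card (S' - (H #> r))"
      "card (A <#> S') = card (A <#> (S' \<inter> (H #> r))) + card (A <#> (S' - (H #> r)))"
      using coset_split[OF fin H AH S'c ne] by metis
    have "card (S' \<inter> (H #> r)) + card A \<le> card (A <#> (S' \<inter> (H #> r))) + 1"
      using sidon_coset_excess_weak[OF fin A, of r "S' \<inter> (H #> r)"] r S'c by (auto simp: H_def)
    moreover have "card (S' - (H #> r)) \<le> card (A <#> (S' - (H #> r)))"
      using S'c by (intro card_set_mult_ge_right[OF fin A(1) _ Ane]) auto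
    ultimately show False using eT s(4,5) r(4,5) neg by linarith
  qed
  have S'le: "card S' \<le> card (A <#> S')"
    by (rule card_set_mult_ge_right[OF fin A(1) S'c Ane])
  have few: "\<not> (2 \<le> card T \<and> 2 \<le> card (Q - (A <#> T)))"
    using sidon_coset_excess[OF fin A sc, of T] TQ s(4,5) S'le neg by (auto simp: Q_def H_def)
  have "T \<noteq> {}" using s by simp
  then have "card T \<noteq> 0" using finT by simp
  show False
  proof (cases "card T = 1")
    case True
    then obtain t where t: "T = {t}" by (auto simp: card_1_singleton_iff)
    have tc: "t \<in> carrier G" using t TQ Qc by auto
    have "card (A <#> T) = card A" using card_r_coset tc A t by (simp add: set_mult_singleton_right)
    then have kap: "\<kappa> = card (H <#> S')" using cardAS s(5) full by simp
    have "card (A - {\<one>}) \<noteq> 0" using A finA by simp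
    then have "A - {\<one>} \<noteq> {}" by (metis card.empty)
    then obtain a where a: "a \<in> A" "a \<noteq> \<one>" by blast
    \<comment> \<open>Here \<open>\<kappa>\<close> is the total size of the other cosets in \<open>HS\<close>, so \<open>{1, a}\<close> would be a fragment
      smaller than \<open>A\<close>.\<close>
    define P where "P = {\<one>, a}"
    have P: "P \<subseteq> carrier G" "card P = 2" "P \<subseteq> H" using a A AH by (auto simp: P_def)
    have "P <#> S = (P <#> T) \<union> (P <#> S')" by (auto simp: set_mult_def T_def S'_def)
    also have "\<dots> \<subseteq> (P #> t) \<union> (H <#> S')" using P t by (auto simp: set_mult_def r_coset_def)
    finally have "card (P <#> S) \<le> card ((P #> t) \<union> (H <#> S'))"
      using finH finS by (intro card_mono) (auto simp: P_def S'_def r_coset_eq_image finite_set_mult)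
    also have "\<dots> \<le> card (P #> t) + card (H <#> S')" by (rule card_Un_le)
    also have "\<dots> = 2 + \<kappa>" using card_r_coset tc P kap by simp
    finally have PS: "card (P <#> S) \<le> 2 + \<kappa>" .
    then show False using strict[OF P(1)] P A cardAS proper by simp
  next
    case False
    then have T2: "2 \<le> card T" using \<open>card T \<noteq> 0\<close> by simp
    have ATQ: "card (A <#> T) + card (Q - (A <#> T)) = card Q"
      using s(3) finQ finA finT card_mono[OF finQ, of "A <#> T"]
      by (simp add: card_Diff_subset finite_set_mult less_imp_le)
    have "Q - (A <#> T) \<noteq> {}" using s(3) by auto
    then have one: "card (Q - (A <#> T)) = 1" using few T2 finQ
      by (metis One_nat_def card_eq_0_iff finite_Diff less_2_cases not_le)
    \<comment> \<open>Now \<open>HS\<close> has one point more than \<open>AS\<close>. Its complement is nonempty and a union of cosets of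
      \<open>H\<close>, so \<open>iso\<close> applies to \<open>H\<close> and bounds \<open>|H|\<close> by \<open>|A| + 1\<close>. This
      leaves at most \<open>|A|\<close> points for \<open>AT\<close>, too few for two translates of the Sidon set \<open>A\<close>.\<close>
    have HSc: "H <#> S \<subseteq> carrier G" using Hc S setmult_subset_G by simp
    have cHS: "card (H <#> S) = card (A <#> S) + 1"
      using s(5,6,7) full ATQ one finQ finH finS by (simp add: card_Un_disjoint finite_set_mult S'_def)
    then have "H <#> S \<noteq> carrier G" using proper by (auto simp: order_def)
    then obtain z where z: "z \<in> carrier G" "z \<notin> H <#> S" using HSc by auto
    have "(H #> z) \<inter> (H <#> S) = {}"
    proof (rule ccontr)
      assume "\<not> ?thesis"
      then obtain g h r where ghr: "g \<in> H" "h \<in> H" "r \<in> S" "g \<otimes> z = h \<otimes> r"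
        by (auto simp: r_coset_def set_mult_def)
      have car: "g \<in> carrier G" "h \<in> carrier G" "r \<in> carrier G" using ghr Hc S by auto
      have "z = inv g \<otimes> (h \<otimes> r)" using ghr(4) car z by (simp add: inv_solve_left)
      then have "z = (inv g \<otimes> h) \<otimes> r" using car by (simp add: m_assoc)
      moreover have "inv g \<otimes> h \<in> H" using ghr H by (simp add: subgroup_def)
      ultimately show False using z ghr by (auto simp: set_mult_def)
    qed
    then have "card ((H #> z) \<union> (H <#> S)) = card H + card (H <#> S)"
      using finH finS card_r_coset[of z H] z Hc
      by (simp add: card_Un_disjoint r_coset_eq_image finite_set_mult)
    moreover have "card ((H #> z) \<union> (H <#> S)) \<le> order G"
      unfolding order_def using HSc r_coset_subset_G[OF Hc z(1)] fin by (intro card_mono) auto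
    ultimately have "card (H <#> S) + 2 \<le> order G" using kH A by simp
    then have "card H + \<kappa> \<le> card (H <#> S)" using iso[OF Hc] kH A by simp
    then have "card (A <#> T) \<le> card A" using cHS cardAS ATQ one cardQ by simp
    moreover have "2 * card A \<le> card (A <#> T) + 1"
    proof -
      obtain t u where tu: "t \<in> T" "u \<in> T" "t \<noteq> u"
        using T2 finT by (metis One_nat_def card_le_Suc0_iff_eq not_less_eq_eq numeral_2_eq_2)
      have tuc: "t \<in> carrier G" "u \<in> carrier G" using tu TQ Qc by auto
      have "card ((A #> t) \<union> (A #> u)) + card ((A #> t) \<inter> (A #> u)) = 2 * card A"
        using card_Un_Int[of "A #> t" "A #> u"] finA card_r_coset tuc A(1)
        by (simp add: r_coset_eq_image)
      moreover have "card ((A #> t) \<inter> (A #> u)) \<le> 1"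
        using sidon_r_coset_meet[OF finA A(1,3) tuc tu(3)] .
      moreover have "card ((A #> t) \<union> (A #> u)) \<le> card (A <#> T)"
        using tu finA finT by (intro card_mono) (auto simp: set_mult_eq_UN_r_coset r_coset_eq_image)
      ultimately show ?thesis by linarith
    qed
    ultimately show False using A by simp
  qed
qed

lemma subset_set_mult_one: "X \<subseteq> carrier G \<Longrightarrow> \<one> \<in> S \<Longrightarrow> X \<subseteq> X <#> S"
  by (force simp: set_mult_def)

lemma card_bdry:
  assumes "finite (carrier G)" "X \<subseteq> carrier G" "S \<subseteq> carrier G" "\<one> \<in> S"
  shows "card (X <#> S) = card X + card (bdry G S X)"
proof -
  have "finite (X <#> S)" using finite_subset[OF setmult_subset_G] assms by blast
  then show ?thesis unfolding bdry_def
    using subset_set_mult_one[of X S] assms card_mono[of "X <#> S" X]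
    by (simp add: card_Diff_subset finite_subset)
qed

lemma admissible_iff:
  assumes "finite (carrier G)" "S \<subseteq> carrier G" "\<one> \<in> S"
  shows "admissible G S k X \<longleftrightarrow> X \<subseteq> carrier G \<and> k \<le> card X \<and> card (X <#> S) + k \<le> order G"
proof (cases "X \<subseteq> carrier G")
  case True
  have sub: "X <#> S \<subseteq> carrier G" using True assms setmult_subset_G by simp
  have "star_compl G S X = carrier G - (X <#> S)"
    using subset_set_mult_one[OF True assms(3)] by (auto simp: star_compl_def bdry_def)
  then have "card (star_compl G S X) + card (X <#> S) = order G"
    using sub assms(1) card_mono[OF assms(1) sub] finite_subset[OF sub]
    by (simp add: card_Diff_subset order_def)
  then show ?thesis using True by (auto simp: admissible_def)
qed (simp add: admissible_def)

lemma kappa_le: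
  assumes "finite (carrier G)" "admissible G S k X"
  shows "kappa G k S \<le> card (bdry G S X)"
proof -
  have "{X. admissible G S k X} \<subseteq> Pow (carrier G)" by (auto simp: admissible_def)
  then have "finite {X. admissible G S k X}" using assms(1) by (simp add: finite_subset)
  then show ?thesis unfolding kappa_def using assms(2) by (intro Min_le) auto
qed

text \<open>
  The atom is translated so as to contain \<open>1\<close>. Not being left-periodic, it is a Sidon set by the intersection
  property, and it is not a subgroup.
\<close>

lemma nonperiodic_two_atom_bound:
  assumes fin: "finite (carrier G)" and S: "S \<subseteq> carrier G" "\<one> \<in> S"
    and large: "2 * card A + kappa G 2 S \<le> order G"
    and atom: "atom G 2 S A" and card3: "3 \<le> card A" and nper: "\<not> left_periodic G A"
  shows "card A + card S \<le> kappa G 2 S + 3"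
proof -
  define \<kappa> where "\<kappa> = kappa G 2 S"
  have fragA: "admissible G S 2 A" "card (bdry G S A) = \<kappa>"
    using atom by (auto simp: atom_def fragment_def \<kappa>_def)
  note adm = admissible_iff[OF fin S]
  have A: "A \<subseteq> carrier G" "card (A <#> S) + 2 \<le> order G"
    using fragA adm by auto
  have iso: "card U + \<kappa> \<le> card (U <#> S)"
    if "U \<subseteq> carrier G" "2 \<le> card U" "card (U <#> S) + 2 \<le> order G" for U
    using kappa_le[OF fin, of S 2 U] that adm card_bdry[OF fin that(1) S] by (simp add: \<kappa>_def)
  have strict: "card J + \<kappa> < card (J <#> S)"
    if "J \<subseteq> carrier G" "2 \<le> card J" "card J < card A" "card (J <#> S) + 2 \<le> order G" for J
  proof -
    have "\<not> fragment G 2 S J" using atom that(3) by (auto simp: atom_def)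
    then have "card (bdry G S J) \<noteq> \<kappa>" using that adm by (simp add: fragment_def \<kappa>_def)
    then show ?thesis using iso[OF that(1,2,4)] card_bdry[OF fin that(1) S] by simp
  qed
  have cAS: "card (A <#> S) = card A + \<kappa>" using card_bdry[OF fin A(1) S] fragA by simp
  obtain a where a: "a \<in> A" using card3 by fastforce
  have ac: "a \<in> carrier G" using a A by auto
  define B where "B = inv a <# A"
  have B: "B \<subseteq> carrier G" using l_coset_subset_G A ac by (simp add: B_def)
  have cB: "card B = card A" using card_l_coset A ac by (simp add: B_def)
  have oneB: "\<one> \<in> B" using a ac by (force simp: B_def l_coset_def)
  have cBS: "card (B <#> S) = card B + \<kappa>"
  proof -
    have "B <#> S = inv a <# (A <#> S)" using setmult_lcos_assoc[of A S "inv a"] A S ac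
      by (simp add: B_def)
    then show ?thesis using card_l_coset[of "inv a" "A <#> S"] A S ac cAS cB by (simp add: setmult_subset_G)
  qed
  have nperB: "x = \<one>" if x: "x \<in> carrier G" "x <# B = B" for x
  proof -
    have "(a \<otimes> x \<otimes> inv a) <# A = a <# (x <# B)"
      using A ac x(1) by (simp add: B_def lcos_m_assoc l_coset_subset_G m_assoc)
    also have "\<dots> = a <# B" using x(2) by simp
    also have "\<dots> = A" using A ac by (simp add: B_def lcos_m_assoc lcos_mult_one)
    finally have "a \<otimes> x \<otimes> inv a = \<one>" using nper ac x by (auto simp: left_periodic_def)
    then have "a \<otimes> x = a" using ac x inv_solve_right'[of \<one> "a \<otimes> x" a] by simp
    then show ?thesis using ac x by simp
  qed
  have "sidon G B"
    unfolding sidon_def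
  proof (intro ballI impI)
    fix x assume x: "x \<in> carrier G" "x \<noteq> \<one>"
    have xBS: "(x <# B) <#> S = x <# (B <#> S)" using setmult_lcos_assoc B S x by simp
    have "card (B \<inter> (x <# B)) \<le> 1 \<or> B = x <# B"
    proof (rule submodular_intersection[where V = "carrier G" and N = "\<lambda>X. X <#> S" and c = \<kappa>])
      show "card ((x <# B) <#> S) = card B + \<kappa>"
        using xBS card_l_coset x B S cBS by (simp add: setmult_subset_G)
      show "(B \<union> (x <# B)) <#> S = (B <#> S) \<union> ((x <# B) <#> S)" by (auto simp: set_mult_def)
      show "(B \<inter> (x <# B)) <#> S \<subseteq> (B <#> S) \<inter> ((x <# B) <#> S)" by (auto simp: set_mult_def)
    qed (use x B S cBS cB fin iso strict large in
        \<open>auto simp: setmult_subset_G card_l_coset l_coset_subset_G order_def \<kappa>_def\<close>)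
    then show "card (B \<inter> (x <# B)) \<le> 1" using nperB x by auto
  qed
  moreover have "\<not> subgroup B G"
  proof
    assume sub: "subgroup B G"
    have "finite B" using B fin finite_subset by auto
    then have "card (B - {\<one>}) \<noteq> 0" using cB card3 oneB by simp
    then have "B - {\<one>} \<noteq> {}" by (metis card.empty)
    then obtain x where x: "x \<in> B" "x \<noteq> \<one>" by blast
    then have "x <# B = B" using coset_join3[OF _ sub] B by auto
    then show False using nperB x B by auto
  qed
  ultimately have "card B + card S \<le> \<kappa> + 3"
    using sidon_two_atom_bound[OF fin S(1) B oneB, of \<kappa>] cB card3 cBS A cAS iso strict by auto
  then show ?thesis by (simp add: cB \<kappa>_def)
qed

end

theorem proposition10:
  fixes G (structure) and S A :: "'a set"
  assumes "group G"
    and "finite (carrier G)"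
    and "S \<subseteq> carrier G"
    and "generate G S = carrier G"
    and "\<one> \<in> S"
    and "separable G 2 S"
    and "card S \<ge> 3"
    and "order G \<ge> 2 * alpha G 2 S + kappa G 2 S"
    and "atom G 2 S A"
    and "card A \<ge> 3"
    and "\<not> left_periodic G A"
  shows "int (card A) \<le> int (kappa G 2 S) - int (card S) + 3"
proof -
  interpret group G by fact
  have "2 * card A + kappa G 2 S \<le> order G"
    using assms(8) alpha_eq_card_atom[OF assms(2,9)] by simp
  then have "card A + card S \<le> kappa G 2 S + 3"
    using nonperiodic_two_atom_bound assms by blast
  then show ?thesis by linarith
qed

end
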